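(* Let $(A,\rhd,\lhd,\mathfrak{B})$ be a Frobenius dialgebra. If $\mathfrak{B}$ is symmetric, then $(A,\rhd,\lhd)$ is a trivial dialgebra, that is, $x\rhd y=x\lhd y=0$ for all $x,y\in A$.
   Context: All vector spaces and algebras are finite-dimensional over a field $\mathbb F$ of characteristic $0$; algebras are not assumed unital. A dialgebra is a triple $(A,\rhd,\lhd)$ where $A$ is a vector space and $\rhd,\lhd$ are associative bilinear products on $A$ such that for all $x,y,z\in A$: $(x\lhd y)\lhd z=x\lhd(y\rhd z)$, $(x\rhd y)\lhd z=x\rhd(y\lhd z)$, $(x\lhd y)\rhd z=x\rhd(y\rhd z)$. A bilinear form $\mathfrak{B}:A\otimes A\to\mathbb F$ on a dialgebra is invariant if $\mathfrak{B}(x\rhd y,z)=\mathfrak{B}(x,y\rhd z-y\lhd z)$ and $\mathfrak{B}(x\lhd y,z)=\mathfrak{B}(x,y\rhd z)$ for all $x,y,z\in A$. A Frobenius dialgebra $(A,\rhd,\lhd,\mathfrak{B})$ is a dialgebra with a nondegenerate invariant bilinear form $\mathfrak{B}$. *)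

theory Defs
  imports Complex_Main
begin

text \<open>
  The library's \<open>bilinear\<close> is restricted to real vector spaces. Here the ground field is
  arbitrary, with scalar multiplications \<open>s1\<close>, \<open>s2\<close>, \<open>s3\<close>; a bilinear map on a tensor product
  is represented by the corresponding curried map.
\<close>

definition bilinear_map ::
  "('f::field \<Rightarrow> 'a::ab_group_add \<Rightarrow> 'a) \<Rightarrow> ('f \<Rightarrow> 'b::ab_group_add \<Rightarrow> 'b) \<Rightarrow>
    ('f \<Rightarrow> 'c::ab_group_add \<Rightarrow> 'c) \<Rightarrow> ('a \<Rightarrow> 'b \<Rightarrow> 'c) \<Rightarrow> bool"
  where "bilinear_map s1 s2 s3 h \<longleftrightarrow>
    (\<forall>x. Vector_Spaces.linear s2 s3 (h x)) \<and> (\<forall>y. Vector_Spaces.linear s1 s3 (\<lambda>x. h x y))"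

locale dialgebra = vector_space scale
  for scale :: "'f::field_char_0 \<Rightarrow> 'a::ab_group_add \<Rightarrow> 'a" (infixr "*s" 75) +
  fixes rprod :: "'a \<Rightarrow> 'a \<Rightarrow> 'a" (infixl "\<rhd>" 70)
    and lprod :: "'a \<Rightarrow> 'a \<Rightarrow> 'a" (infixl "\<lhd>" 70)
  assumes finite_dimensional: "\<exists>S. finite S \<and> span S = UNIV"
    and bilinear_rprod: "bilinear_map scale scale scale (\<rhd>)"
    and bilinear_lprod: "bilinear_map scale scale scale (\<lhd>)"
    and rprod_assoc: "(x \<rhd> y) \<rhd> z = x \<rhd> (y \<rhd> z)"
    and lprod_assoc: "(x \<lhd> y) \<lhd> z = x \<lhd> (y \<lhd> z)"
    and lprod_lprod: "(x \<lhd> y) \<lhd> z = x \<lhd> (y \<rhd> z)"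
    and rprod_lprod: "(x \<rhd> y) \<lhd> z = x \<rhd> (y \<lhd> z)"
    and lprod_rprod: "(x \<lhd> y) \<rhd> z = x \<rhd> (y \<rhd> z)"

definition nondegenerate_form :: "('a::zero \<Rightarrow> 'a \<Rightarrow> 'f::zero) \<Rightarrow> bool"
  where "nondegenerate_form B \<longleftrightarrow>
    (\<forall>x. (\<forall>y. B x y = 0) \<longrightarrow> x = 0) \<and> (\<forall>y. (\<forall>x. B x y = 0) \<longrightarrow> y = 0)"

definition symmetric_form :: "('a \<Rightarrow> 'a \<Rightarrow> 'f) \<Rightarrow> bool"
  where "symmetric_form B \<longleftrightarrow> (\<forall>x y. B x y = B y x)"

definition invariant_form ::
  "('a::minus \<Rightarrow> 'a \<Rightarrow> 'a) \<Rightarrow> ('a \<Rightarrow> 'a \<Rightarrow> 'a) \<Rightarrow> ('a \<Rightarrow> 'a \<Rightarrow> 'f) \<Rightarrow> bool"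
  where "invariant_form rprod lprod B \<longleftrightarrow>
    (\<forall>x y z. B (rprod x y) z = B x (rprod y z - lprod y z)) \<and>
    (\<forall>x y z. B (lprod x y) z = B x (rprod y z))"

locale frobenius_dialgebra = dialgebra scale rprod lprod
  for scale :: "'f::field_char_0 \<Rightarrow> 'a::ab_group_add \<Rightarrow> 'a" (infixr "*s" 75)
    and rprod :: "'a \<Rightarrow> 'a \<Rightarrow> 'a" (infixl "\<rhd>" 70)
    and lprod :: "'a \<Rightarrow> 'a \<Rightarrow> 'a" (infixl "\<lhd>" 70) +
  fixes B :: "'a \<Rightarrow> 'a \<Rightarrow> 'f"
  assumes bilinear_form: "bilinear_map scale scale (*) B"
    and nondegenerate: "nondegenerate_form B"
    and invariant: "invariant_form (\<rhd>) (\<lhd>) B"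

definition trivial_dialgebra :: "('a::zero \<Rightarrow> 'a \<Rightarrow> 'a) \<Rightarrow> ('a \<Rightarrow> 'a \<Rightarrow> 'a) \<Rightarrow> bool"
  where "trivial_dialgebra rprod lprod \<longleftrightarrow> (\<forall>x y. rprod x y = 0 \<and> lprod x y = 0)"

end

theory Submission
  imports Defs
begin

text \<open>
  By symmetry the two invariance conditions say that the trilinear form
  \<open>R x y z = B (x \<rhd> y) z\<close> satisfies \<open>R x y z = R y z x - R z x y\<close> and that
  \<open>B (x \<lhd> y) z = R y z x\<close>. The first identity and its cyclic shift \<open>R y z x = R z x y - R x y z\<close>
  give \<open>R x y z = - R x y z\<close>. Hence \<open>R = 0\<close> in characteristic \<open>0\<close>, and nondegeneracy concludes.
\<close>

theorem proposition2p18: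
  fixes scale :: "'f::field_char_0 \<Rightarrow> 'a::ab_group_add \<Rightarrow> 'a"
    and rprod lprod :: "'a \<Rightarrow> 'a \<Rightarrow> 'a"
    and B :: "'a \<Rightarrow> 'a \<Rightarrow> 'f"
  assumes "frobenius_dialgebra scale rprod lprod B"
    and "symmetric_form B"
  shows "trivial_dialgebra rprod lprod"
proof -
  interpret frobenius_dialgebra scale rprod lprod B
    by (fact assms(1))
  have sym: "B x y = B y x" for x y
    using assms(2) by (simp add: symmetric_form_def)
  have B_diff: "B x (y - z) = B x y - B x z" for x y z
    using bilinear_form unfolding bilinear_map_def
    by (meson Vector_Spaces.linear_iff_module_hom module_hom.diff)
  have lprod_form: "B (lprod x y) z = B (rprod y z) x" for x y z
    using invariant sym[of x] by (simp add: invariant_form_def)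
  have cyclic: "B (rprod x y) z = B (rprod y z) x - B (rprod z x) y" for x y z
  proof -
    have "B (rprod x y) z = B x (rprod y z) - B x (lprod y z)"
      using invariant by (simp add: invariant_form_def B_diff)
    then show ?thesis
      \<comment> \<open>Symmetry moves \<open>x\<close> to the second slot, where
        \<open>lprod_form\<close> turns \<open>B (lprod y z) x\<close> into
        \<open>B (rprod z x) y\<close>.\<close>
      by (simp add: sym[of x] lprod_form)
  qed
  have rprod_form: "B (rprod x y) z = 0" for x y z
  proof -
    have "B (rprod x y) z = - B (rprod x y) z"
      using cyclic[of x y z] cyclic[of y z x] by (simp add: algebra_simps)
    then show ?thesis
      \<comment> \<open>Twice the value is \<open>0\<close>, and \<open>2\<close> is invertible in
        characteristic \<open>0\<close>.\<close>
      by (simp add: eq_neg_iff_add_eq_0 flip: mult_2)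
  qed
  \<comment> \<open>Both products lie in the left radical of \<open>B\<close>:
    \<open>lprod_form\<close> rewrites each pairing with \<open>lprod x y\<close> as one that
    \<open>rprod_form\<close> kills.\<close>
  have "rprod x y = 0" "lprod x y = 0" for x y
    using nondegenerate rprod_form lprod_form by (simp_all add: nondegenerate_form_def)
  then show ?thesis
    by (simp add: trivial_dialgebra_def)
qed

end
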